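(* Let $S$ be a monoid and let $a,b,d\in S$. If $a$ is invertible along $d$, then the following conditions are equivalent: (i) $b$ is invertible along $d$; (ii) $adb$ is invertible along $d$; (iii) $bda$ is invertible along $d$. In this case, $(adb)^{\parallel d}=b^{\parallel d}d^{(1)}a^{\parallel d}$ and $(bda)^{\parallel d}=a^{\parallel d}d^{(1)}b^{\parallel d}$ for every inner inverse $d^{(1)}$ of $d$.
   Context: In a monoid $S$, write $x\leq_{\mathcal H}d$ if $Sx\subseteq Sd$ and $xS\subseteq dS$. An element $a\in S$ is invertible along $d\in S$ if there exists $b\in S$ such that $bad=d=dab$ and $b\leq_{\mathcal H}d$. Such $b$ is unique if it exists; it is called the inverse of $a$ along $d$ and denoted $a^{\parallel d}$. An inner inverse of $d$ is an element $d^{(1)}\in S$ with $dd^{(1)}d=d$; $d$ is regular if it has an inner inverse. (It is known that if some element is invertible along $d$, then $d$ is regular.) *)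

theory Defs
  imports Main
begin

definition h_le :: "'a::monoid_mult \<Rightarrow> 'a \<Rightarrow> bool"  (infix "\<le>\<^sub>H" 50) where
  "x \<le>\<^sub>H d \<longleftrightarrow> range (\<lambda>s. s * x) \<subseteq> range (\<lambda>s. s * d) \<and> range (\<lambda>s. x * s) \<subseteq> range (\<lambda>s. d * s)"

definition is_inverse_along :: "'a::monoid_mult \<Rightarrow> 'a \<Rightarrow> 'a \<Rightarrow> bool" where
  "is_inverse_along a d b \<longleftrightarrow> b * a * d = d \<and> d * a * b = d \<and> b \<le>\<^sub>H d"

definition invertible_along :: "'a::monoid_mult \<Rightarrow> 'a \<Rightarrow> bool" where
  "invertible_along a d \<longleftrightarrow> (\<exists>b. is_inverse_along a d b)"

text \<open>Well defined by uniqueness, shown below; unspecified when \<open>a\<close> is not invertible along \<open>d\<close>.\<close>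

definition inverse_along :: "'a::monoid_mult \<Rightarrow> 'a \<Rightarrow> 'a" where
  "inverse_along a d = (THE b. is_inverse_along a d b)"

definition inner_inverse :: "'a::monoid_mult \<Rightarrow> 'a \<Rightarrow> bool" where
  "inner_inverse d x \<longleftrightarrow> d * x * d = d"

lemma is_inverse_along_unique:
  assumes "is_inverse_along a d b" and "is_inverse_along a d c"
  shows "b = c"
proof -
  have "1 * b \<in> range (\<lambda>s. s * d)" and "c * 1 \<in> range (\<lambda>s. d * s)"
    using assms unfolding is_inverse_along_def h_le_def by blast+
  then obtain x y where b: "b = x * d" and c: "c = d * y" by auto
  have "b = x * (d * a * c)" using assms(2) b by (simp add: is_inverse_along_def)
  also have "\<dots> = b * a * c" by (simp add: b mult.assoc)
  also have "\<dots> = (b * a * d) * y" by (simp add: c mult.assoc)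
  also have "\<dots> = c" using assms(1) c by (simp add: is_inverse_along_def)
  finally show ?thesis .
qed

lemma is_inverse_along_inverse_along:
  "invertible_along a d \<Longrightarrow> is_inverse_along a d (inverse_along a d)"
  unfolding invertible_along_def inverse_along_def
  by (metis is_inverse_along_unique theI)

end

theory Submission
  imports Defs
begin

text \<open>
  Invertibility of \<open>a\<close> along \<open>d\<close> amounts to \<open>d\<close> lying in both \<open>S d a d\<close> and \<open>d a d S\<close>.  When \<open>a\<close> is
  invertible along \<open>d\<close>, multiplication by its inverse cancels \<open>a\<close> next to \<open>d\<close>, so this criterion for
  \<open>a d b\<close> or \<open>b d a\<close> reduces to the one for \<open>b\<close>.
\<close>

lemma h_le_iff: "x \<le>\<^sub>H d \<longleftrightarrow> (\<exists>s. x = s * d) \<and> (\<exists>t. x = d * t)"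
proof
  assume "x \<le>\<^sub>H d"
  then have "1 * x \<in> range (\<lambda>s. s * d)" and "x * 1 \<in> range (\<lambda>s. d * s)"
    unfolding h_le_def by blast+
  then show "(\<exists>s. x = s * d) \<and> (\<exists>t. x = d * t)" by auto
next
  assume "(\<exists>s. x = s * d) \<and> (\<exists>t. x = d * t)"
  then obtain s t where "x = s * d" and "x = d * t" by blast
  then have "r * x = (r * s) * d" and "x * r = d * (t * r)" for r
    by (metis mult.assoc)+
  then show "x \<le>\<^sub>H d" unfolding h_le_def by blast
qed

lemma is_inverse_along_E:
  assumes "is_inverse_along a d c"
  obtains s t where "c = s * d" and "c = d * t" and "c * a * d = d" and "d * a * c = d"
  using assms unfolding is_inverse_along_def h_le_iff by blast

text \<open>Forwards, write the inverse as \<open>s * d\<close> and as \<open>d * t\<close> in its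
  two defining equations. Backwards, both \<open>s * d\<close> and \<open>d * t\<close> equal
  \<open>s * d * a * d * t\<close>, so they coincide; this common element is the inverse, and its
  two forms place it below \<open>d\<close>.\<close>

lemma invertible_along_iff:
  "invertible_along a d \<longleftrightarrow> (\<exists>s. d = s * d * a * d) \<and> (\<exists>t. d = d * a * d * t)"
proof
  assume "invertible_along a d"
  then obtain c where "is_inverse_along a d c" unfolding invertible_along_def by blast
  then show "(\<exists>s. d = s * d * a * d) \<and> (\<exists>t. d = d * a * d * t)"
    by (elim is_inverse_along_E) (metis mult.assoc)
next
  assume "(\<exists>s. d = s * d * a * d) \<and> (\<exists>t. d = d * a * d * t)"
  then obtain s t where s: "d = s * d * a * d" and t: "d = d * a * d * t" by blast
  have "s * d = s * (d * a * d * t)" using t by simp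
  also have "\<dots> = (s * d * a * d) * t" by (simp add: mult.assoc)
  also have "\<dots> = d * t" using s by simp
  finally have eq: "s * d = d * t" .
  have "is_inverse_along a d (s * d)"
    unfolding is_inverse_along_def h_le_iff
  proof (intro conjI exI)
    show "s * d * a * d = d" using s by simp
    show "d * a * (s * d) = d" unfolding eq using t by (simp add: mult.assoc)
    show "s * d = d * t" by (rule eq)
  qed simp
  then show "invertible_along a d" unfolding invertible_along_def by blast
qed

text \<open>Since \<open>b'\<close> is a left multiple of \<open>d\<close> and \<open>a'\<close> a
  right multiple, \<open>b'\<close> absorbs \<open>d1 * d\<close> on its right and \<open>a'\<close>
  absorbs \<open>d * d1\<close> on its left. Both products therefore collapse from the inside: one
  inverse cancels, the inner inverse disappears, and the other inverse cancels.\<close>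

lemma is_inverse_along_mult:
  assumes a: "is_inverse_along a d a'" and b: "is_inverse_along b d b'"
    and d1: "inner_inverse d d1"
  shows "is_inverse_along (a * d * b) d (b' * d1 * a')"
proof -
  obtain sa ta where a': "a' = sa * d" "a' = d * ta" "a' * a * d = d" "d * a * a' = d"
    using a by (rule is_inverse_along_E)
  obtain sb tb where b': "b' = sb * d" "b' = d * tb" "b' * b * d = d" "d * b * b' = d"
    using b by (rule is_inverse_along_E)
  have d: "d * d1 * d = d" using d1 by (simp add: inner_inverse_def)
  have left: "b' * d1 * d = b'" using d b'(1) by (metis mult.assoc)
  have right: "d * d1 * a' = a'" using d a'(2) by (metis mult.assoc)
  show ?thesis
    unfolding is_inverse_along_def h_le_iff
  proof (intro conjI exI)
    have "b' * d1 * a' * (a * d * b) * d = b' * d1 * (a' * a * d) * b * d"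
      by (simp add: mult.assoc)
    also have "\<dots> = d" using a'(3) left b'(3) by simp
    finally show "b' * d1 * a' * (a * d * b) * d = d" .
    have "d * (a * d * b) * (b' * d1 * a') = d * a * (d * b * b') * d1 * a'"
      by (simp add: mult.assoc)
    also have "\<dots> = d * a * (d * d1 * a')" using b'(4) by (simp add: mult.assoc)
    also have "\<dots> = d" using right a'(4) by simp
    finally show "d * (a * d * b) * (b' * d1 * a') = d" .
    show "b' * d1 * a' = (b' * d1 * sa) * d" using a'(1) by (simp add: mult.assoc)
    show "b' * d1 * a' = d * (tb * d1 * a')" using b'(2) by (simp add: mult.assoc)
  qed
qed

text \<open>Only the right-hand factorization of \<open>d\<close> needs work, because the left-hand
  one for \<open>a * d * b\<close> already ends in \<open>d * b * d\<close>.\<close>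

lemma invertible_along_mult_left_cancel:
  assumes a: "invertible_along a d" and ab: "invertible_along (a * d * b) d"
  shows "invertible_along b d"
proof -
  obtain a' where "is_inverse_along a d a'" using a unfolding invertible_along_def by blast
  then obtain x where a': "a' = x * d" "a' * a * d = d"
    by (elim is_inverse_along_E)
  obtain s t where s: "d = s * d * (a * d * b) * d" and t: "d = d * (a * d * b) * d * t"
    using ab unfolding invertible_along_iff by blast
  \<comment> \<open>Multiplying by \<open>x\<close> turns the leading \<open>d\<close> into
    \<open>a'\<close>, which then cancels \<open>a\<close>. Multiplying the result by
    \<open>a * d\<close> on the right recovers \<open>d\<close>.\<close>
  have "a' = x * (d * (a * d * b) * d * t)" using a'(1) t by simp
  also have "\<dots> = (a' * a * d) * b * d * t" by (simp add: a'(1) mult.assoc)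
  also have "\<dots> = d * b * d * t" using a'(2) by simp
  finally have "d = d * b * d * (t * a * d)" using a'(2) by (simp add: mult.assoc)
  moreover have "d = (s * d * a) * d * b * d" using s by (simp add: mult.assoc)
  ultimately show ?thesis unfolding invertible_along_iff by blast
qed

text \<open>The left-right mirror image of the previous argument: \<open>y\<close> turns the final
  \<open>d\<close> into \<open>a'\<close>, and \<open>d * a\<close> on the left recovers
  \<open>d\<close>.\<close>

lemma invertible_along_mult_right_cancel:
  assumes a: "invertible_along a d" and ba: "invertible_along (b * d * a) d"
  shows "invertible_along b d"
proof -
  obtain a' where "is_inverse_along a d a'" using a unfolding invertible_along_def by blast
  then obtain y where a': "a' = d * y" "d * a * a' = d"
    by (elim is_inverse_along_E)
  obtain s t where s: "d = s * d * (b * d * a) * d" and t: "d = d * (b * d * a) * d * t"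
    using ba unfolding invertible_along_iff by blast
  have "a' = (s * d * (b * d * a) * d) * y" using a'(1) s by simp
  also have "\<dots> = s * d * b * (d * a * a')" by (simp add: a'(1) mult.assoc)
  also have "\<dots> = s * d * b * d" using a'(2) by simp
  finally have "d = (d * a * s) * d * b * d" using a'(2) by (simp add: mult.assoc)
  moreover have "d = d * b * d * (a * d * t)" using t by (simp add: mult.assoc)
  ultimately show ?thesis unfolding invertible_along_iff by blast
qed

text \<open>Writing the inverse as \<open>d * t\<close> turns \<open>c * a * d = d\<close> into
  regularity of \<open>d\<close>.\<close>

lemma inner_inverse_if_invertible_along:
  assumes "invertible_along a d"
  obtains d1 where "inner_inverse d d1"
proof -
  obtain c where "is_inverse_along a d c" using assms unfolding invertible_along_def by blast
  then obtain s t where "c = d * t" "c * a * d = d" by (elim is_inverse_along_E)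
  then have "inner_inverse d (t * a)" by (simp add: inner_inverse_def mult.assoc)
  then show ?thesis by (rule that)
qed

lemma inverse_along_eqI: "is_inverse_along a d c \<Longrightarrow> inverse_along a d = c"
  unfolding inverse_along_def by (blast intro: is_inverse_along_unique)

theorem theorem2p19:
  fixes a b d :: "'a::monoid_mult"
  assumes "invertible_along a d"
  shows "(invertible_along b d \<longleftrightarrow> invertible_along (a * d * b) d) \<and>
         (invertible_along b d \<longleftrightarrow> invertible_along (b * d * a) d) \<and>
         (invertible_along b d \<longrightarrow>
            (\<forall>d1. inner_inverse d d1 \<longrightarrow>
               inverse_along (a * d * b) d = inverse_along b d * d1 * inverse_along a d \<and>
               inverse_along (b * d * a) d = inverse_along a d * d1 * inverse_along b d))"
proof -
  \<comment> \<open>The equivalences mention no inner inverse, but their forward directions use the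
    product formula, which needs one.\<close>
  obtain d0 where d0: "inner_inverse d d0"
    using assms by (rule inner_inverse_if_invertible_along)
  have a: "is_inverse_along a d (inverse_along a d)"
    using assms by (rule is_inverse_along_inverse_along)
  \<comment> \<open>The second formula is the first with \<open>a\<close> and \<open>b\<close>
    exchanged.\<close>
  have products:
    "is_inverse_along (a * d * b) d (inverse_along b d * d1 * inverse_along a d)"
    "is_inverse_along (b * d * a) d (inverse_along a d * d1 * inverse_along b d)"
    if "invertible_along b d" and "inner_inverse d d1" for d1
    using a is_inverse_along_inverse_along[OF that(1)] that(2)
    by (simp_all add: is_inverse_along_mult)
  have "invertible_along b d \<longleftrightarrow> invertible_along (a * d * b) d"
    using products(1)[OF _ d0] invertible_along_mult_left_cancel[OF assms]
    by (auto simp: invertible_along_def)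
  moreover have "invertible_along b d \<longleftrightarrow> invertible_along (b * d * a) d"
    using products(2)[OF _ d0] invertible_along_mult_right_cancel[OF assms]
    by (auto simp: invertible_along_def)
  ultimately show ?thesis
    using products by (simp add: inverse_along_eqI)
qed

end
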